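(* Let $\mathcal{I}=C_1\wedge\cdots\wedge C_m$ be a 3,4-SAT instance in variables $X_1,\ldots,X_n$, such that for every $i$ both literals $X_i$ and $\overline{X}_i$ appear in at least one clause each, and never both in the same clause. Let $\mathbb{F}$ be a field and let $\mathcal{F}=F_v\cup F_c\cup F_1\cup F_2$ be the set of polynomials constructed from $\mathcal{I}$ as described in the context. Then $\mathcal{I}$ is satisfiable if and only if there is an order ideal $\mathcal{O}$ such that $\mathcal{F}$ is an $\mathcal{O}$-border basis of the ideal $\langle\mathcal{F}\rangle$.
   Context: 3,4-SAT instance: a conjunction of clauses, each a disjunction of three literals in three distinct variables, such that for each variable $X_i$ the number of clauses containing $X_i$ or $\overline{X}_i$ is at most four. Order ideals and border bases. In a polynomial ring over $\mathbb{F}$ in finitely many indeterminates $y_1,\ldots,y_N$, a term is a monomial $y_1^{\alpha_1}\cdots y_N^{\alpha_N}$ (coefficient 1), and $\deg$ denotes total degree. A non-empty finite set $\mathcal{O}$ of terms is an order ideal if it is closed under taking divisors. Its border is $\partial\mathcal{O}=(y_1\mathcal{O}\cup\cdots\cup y_N\mathcal{O})\setminus\mathcal{O}$. If $\mathcal{O}=\{t_1,\ldots,t_\mu\}$ and $\partial\mathcal{O}=\{b_1,\ldots,b_\nu\}$, a set $G=\{g_1,\ldots,g_\nu\}$ of polynomials is an $\mathcal{O}$-border prebasis if $g_j=b_j-\sum_{i=1}^\mu\alpha_{ij}t_i$ with $\alpha_{ij}\in\mathbb{F}$ for each $j$. An $\mathcal{O}$-border prebasis $G$ contained in an ideal $\mathfrak{a}$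 is an $\mathcal{O}$-border basis of $\mathfrak{a}$ if the residue classes of $t_1,\ldots,t_\mu$ form an $\mathbb{F}$-vector space basis of the polynomial ring modulo $\mathfrak{a}$. Construction of $\mathcal{F}$. Work in $P=\mathbb{F}[x_1,\ldots,x_n,\overline{x}_1,\ldots,\overline{x}_n,c_1,\ldots,c_m,x_{c_1},\ldots,x_{c_m},X]$, a polynomial ring in $N=2n+2m+1$ indeterminates. For a term $t$ let $k(t)=\{t' : t'y=t\text{ for some indeterminate }y\}$ (children of $t$), and for a set $S$ of terms let $k(S)=\bigcup_{t\in S}k(t)$. If an indeterminate $x$ divides $t$, then $\frac{t}{x}$ is the term $t'$ with $t'x=t$. For $i=1,\ldots,n$: - $t_{C_{x_i}}=\bigl(\prod_{j\in S}c_j\bigr)X^{4-|S|}$, where $S\subset\{1,\ldots,m\}$ is the set of all $j$ such that $X_i$ or $\overline{X}_i$ appears in $C_j$ (a term of degree 4); - $t_{X_i}=x_i\overline{x}_i^2\,t_{C_{x_i}}$ and $t_{\overline{X}_i}=x_i^2\overline{x}_i\,t_{C_{x_i}}$ (terms of degree 7); - for each literal $L\in\{X_i,\overline{X}_i\}$: $K_L=\{\frac{t_Lx_{c_l}}{c_l} : L\text{ appears in }C_l\}$ and $P_L=\{t_Lx_{c_l} : L\text{ appears in }C_l\}$; - $K_i=K_{X_i}\cup K_{\overline{X}_i}\cup\{t_{X_i},t_{\overline{X}_i}\}$, $P_i=P_{X_i}\cup P_{\overline{X}_i}$, $R_i=k(P_i)$. Then - $F_v=\{t_{X_i}+t_{\overline{X}_i}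 : i=1,\ldots,n\}$; - $F_c$ consists, for each clause $C_l=(L_1\vee L_2\vee L_3)$ with literals $L_1,L_2,L_3$, of the polynomial $\frac{t_{L_1}x_{c_l}}{c_l}+\frac{t_{L_2}x_{c_l}}{c_l}+\frac{t_{L_3}x_{c_l}}{c_l}$; - $F_1$ is the set of all terms of $P$ of total degree $8$; - $F_2=\bigcup_{i=1}^n(R_i\setminus K_i)$; - $\mathcal{F}=F_v\cup F_c\cup F_1\cup F_2$. *)

theory Defs
  imports Complex_Main "HOL-Library.Poly_Mapping"
begin

section \<open>3,4-SAT\<close>

datatype 'n literal = Pos 'n | Neg 'n

primrec variable_of :: "'n literal \<Rightarrow> 'n" where
  "variable_of (Pos i) = i"
| "variable_of (Neg i) = i"

primrec holds :: "('n \<Rightarrow> bool) \<Rightarrow> 'n literal \<Rightarrow> bool" where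
  "holds v (Pos i) \<longleftrightarrow> v i"
| "holds v (Neg i) \<longleftrightarrow> \<not> v i"

text \<open>
  An instance is a family of clauses indexed by \<^typ>\<open>'m\<close> over variables indexed by \<^typ>\<open>'n\<close>;
  a clause is the set of its literals. Different indices may carry the same clause, and the
  occurrences of a variable are counted by index.
\<close>

definition occurrences :: "('m \<Rightarrow> 'n literal set) \<Rightarrow> 'n \<Rightarrow> 'm set" where
  "occurrences cl i = {l. Pos i \<in> cl l \<or> Neg i \<in> cl l}"

definition is_34SAT :: "('m::finite \<Rightarrow> 'n literal set) \<Rightarrow> bool" where
  "is_34SAT cl \<longleftrightarrow>
     (\<forall>l. card (cl l) = 3 \<and> inj_on variable_of (cl l)) \<and>
     (\<forall>i. card (occurrences cl i) \<le> 4)"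

definition satisfiable :: "('m \<Rightarrow> 'n literal set) \<Rightarrow> bool" where
  "satisfiable cl \<longleftrightarrow> (\<exists>v. \<forall>l. \<exists>L\<in>cl l. holds v L)"


section \<open>Terms and polynomials\<close>

text \<open>
  A term is represented by its exponent vector, so products of terms are written additively:
  \<open>s + t\<close> is the product, \<open>0\<close> is the term 1, and \<open>t - ind x\<close> is the quotient \<open>t/x\<close>
  when \<open>x\<close> divides \<open>t\<close>. Polynomials have their ring structure from \<^theory>\<open>HOL-Library.Poly_Mapping\<close>,
  and \<open>Poly_Mapping.single t a\<close> is the polynomial \<open>a\<cdot>t\<close>.
\<close>

type_synonym 'v pterm = "'v \<Rightarrow>\<^sub>0 nat"
type_synonym ('v, 'k) mpoly = "('v \<Rightarrow>\<^sub>0 nat) \<Rightarrow>\<^sub>0 'k"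

definition ind :: "'v \<Rightarrow> 'v pterm" where
  "ind y = Poly_Mapping.single y 1"

definition total_degree :: "'v::finite pterm \<Rightarrow> nat" where
  "total_degree t = (\<Sum>y\<in>UNIV. Poly_Mapping.lookup t y)"

definition term_dvd :: "'v pterm \<Rightarrow> 'v pterm \<Rightarrow> bool" where
  "term_dvd s t \<longleftrightarrow> (\<exists>u. t = s + u)"

definition mon :: "'v pterm \<Rightarrow> ('v, 'k::field) mpoly" where
  "mon t = Poly_Mapping.single t 1"

definition lincomb :: "'v pterm set \<Rightarrow> ('v pterm \<Rightarrow> 'k::field) \<Rightarrow> ('v, 'k) mpoly" where
  "lincomb T a = (\<Sum>t\<in>T. Poly_Mapping.single t (a t))"


section \<open>Border bases\<close>

definition order_ideal :: "'v::finite pterm set \<Rightarrow> bool" where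
  "order_ideal T \<longleftrightarrow> T \<noteq> {} \<and> finite T \<and> (\<forall>t\<in>T. \<forall>s. term_dvd s t \<longrightarrow> s \<in> T)"

definition border :: "'v::finite pterm set \<Rightarrow> 'v pterm set" where
  "border T = {ind y + t | y t. t \<in> T} - T"

definition border_prebasis :: "'v::finite pterm set \<Rightarrow> ('v, 'k::field) mpoly set \<Rightarrow> bool" where
  "border_prebasis T G \<longleftrightarrow>
     (\<exists>a :: 'v pterm \<Rightarrow> 'v pterm \<Rightarrow> 'k. G = {mon b - lincomb T (a b) | b. b \<in> border T})"

text \<open>
  A commutative ring is a module over itself; its submodules are its ideals, and the span of
  a set is the ideal generated by it.
\<close>

definition is_ideal :: "'a::comm_ring_1 set \<Rightarrow> bool" where
  "is_ideal I \<longleftrightarrow> module.subspace (*) I"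

definition ideal_generated :: "'a::comm_ring_1 set \<Rightarrow> 'a set" where
  "ideal_generated S = module.span (*) S"

definition residue_class :: "'a::comm_ring_1 set \<Rightarrow> 'a \<Rightarrow> 'a set" where
  "residue_class I p = {p + q | q. q \<in> I}"

text \<open>
  The residue classes of the terms in \<open>T\<close> form a vector space basis of the quotient by \<open>I\<close>.
  A linear combination of the classes of the terms is the class of the linear combination of
  the terms, by definition of the vector space operations on the quotient. The first conjunct is
  linear independence of the family of classes, the second is that it spans.
\<close>

definition residue_classes_basis ::
    "'v::finite pterm set \<Rightarrow> ('v, 'k::field) mpoly set \<Rightarrow> bool" where
  "residue_classes_basis T I \<longleftrightarrow>
     (\<forall>a. residue_class I (lincomb T a) = residue_class I 0 \<longrightarrow> (\<forall>t\<in>T. a t = 0)) \<and>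
     (\<forall>p. \<exists>a. residue_class I p = residue_class I (lincomb T a))"

definition border_basis ::
    "'v::finite pterm set \<Rightarrow> ('v, 'k::field) mpoly set \<Rightarrow> ('v, 'k) mpoly set \<Rightarrow> bool" where
  "border_basis T G I \<longleftrightarrow>
     border_prebasis T G \<and> is_ideal I \<and> G \<subseteq> I \<and> residue_classes_basis T I"


section \<open>The polynomials constructed from an instance\<close>

text \<open>
  The indeterminates are, in this order: the positive ones \<open>x\<^sub>i\<close>, the overlined ones, the \<open>c\<^sub>l\<close>,
  the \<open>x\<close> with subscript \<open>c\<^sub>l\<close>, and \<open>X\<close>.
\<close>

datatype ('n, 'm) indet = Xp 'n | Xn 'n | Cl 'm | Xc 'm | BigX

lemma UNIV_indet: "UNIV = range Xp \<union> range Xn \<union> range Cl \<union> range Xc \<union> {BigX}"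
proof -
  have "y \<in> range Xp \<union> range Xn \<union> range Cl \<union> range Xc \<union> {BigX}" for y :: "('n, 'm) indet"
    by (cases y) auto
  then show ?thesis by blast
qed

instance indet :: (finite, finite) finite
  by standard (simp add: UNIV_indet)

definition children :: "'v pterm \<Rightarrow> 'v pterm set" where
  "children t = {t'. \<exists>y. t' + ind y = t}"

definition t_C :: "('m::finite \<Rightarrow> 'n literal set) \<Rightarrow> 'n \<Rightarrow> ('n, 'm) indet pterm" where
  "t_C cl i = (\<Sum>j\<in>occurrences cl i. ind (Cl j))
            + Poly_Mapping.single BigX (4 - card (occurrences cl i))"

primrec t_lit :: "('m::finite \<Rightarrow> 'n literal set) \<Rightarrow> 'n literal \<Rightarrow> ('n, 'm) indet pterm" where
  "t_lit cl (Pos i) = ind (Xp i) + ind (Xn i) + ind (Xn i) + t_C cl i"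
| "t_lit cl (Neg i) = ind (Xp i) + ind (Xp i) + ind (Xn i) + t_C cl i"

text \<open>
  The term \<open>t\<^sub>L x\<^sub>c / c\<close> for \<open>c = c\<^sub>l\<close>. It is used only if \<open>L\<close> appears in clause \<open>l\<close>,
  and then \<open>c\<^sub>l\<close> divides \<open>t\<^sub>L\<close>, so the truncated subtraction of exponents is a true quotient.
\<close>

definition t_clause ::
    "('m::finite \<Rightarrow> 'n literal set) \<Rightarrow> 'n literal \<Rightarrow> 'm \<Rightarrow> ('n, 'm) indet pterm" where
  "t_clause cl L l = t_lit cl L + ind (Xc l) - ind (Cl l)"

definition K_lit :: "('m::finite \<Rightarrow> 'n literal set) \<Rightarrow> 'n literal \<Rightarrow> ('n, 'm) indet pterm set" where
  "K_lit cl L = {t_clause cl L l | l. L \<in> cl l}"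

definition P_lit :: "('m::finite \<Rightarrow> 'n literal set) \<Rightarrow> 'n literal \<Rightarrow> ('n, 'm) indet pterm set" where
  "P_lit cl L = {t_lit cl L + ind (Xc l) | l. L \<in> cl l}"

definition K_var :: "('m::finite \<Rightarrow> 'n literal set) \<Rightarrow> 'n \<Rightarrow> ('n, 'm) indet pterm set" where
  "K_var cl i = K_lit cl (Pos i) \<union> K_lit cl (Neg i) \<union> {t_lit cl (Pos i), t_lit cl (Neg i)}"

definition P_var :: "('m::finite \<Rightarrow> 'n literal set) \<Rightarrow> 'n \<Rightarrow> ('n, 'm) indet pterm set" where
  "P_var cl i = P_lit cl (Pos i) \<union> P_lit cl (Neg i)"

definition R_var :: "('m::finite \<Rightarrow> 'n literal set) \<Rightarrow> 'n \<Rightarrow> ('n, 'm) indet pterm set" where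
  "R_var cl i = (\<Union>t\<in>P_var cl i. children t)"

definition F_v :: "('m::finite \<Rightarrow> 'n::finite literal set) \<Rightarrow> (('n, 'm) indet, 'k::field) mpoly set" where
  "F_v cl = range (\<lambda>i. mon (t_lit cl (Pos i)) + mon (t_lit cl (Neg i)))"

definition F_c :: "('m::finite \<Rightarrow> 'n::finite literal set) \<Rightarrow> (('n, 'm) indet, 'k::field) mpoly set" where
  "F_c cl = range (\<lambda>l. \<Sum>L\<in>cl l. mon (t_clause cl L l))"

definition F_1 :: "('v::finite, 'k::field) mpoly set" where
  "F_1 = mon ` {t. total_degree t = 8}"

definition F_2 :: "('m::finite \<Rightarrow> 'n::finite literal set) \<Rightarrow> (('n, 'm) indet, 'k::field) mpoly set" where
  "F_2 cl = mon ` (\<Union>i. R_var cl i - K_var cl i)"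

definition F_all :: "('m::finite \<Rightarrow> 'n::finite literal set) \<Rightarrow> (('n, 'm) indet, 'k::field) mpoly set" where
  "F_all cl = F_v cl \<union> F_c cl \<union> F_1 \<union> F_2 cl"

end

theory Submission
  imports Defs
begin

text \<open>
  Since all terms of degree 8 belong to \<open>F\<close> and the other elements of \<open>F\<close> are homogeneous of degree 7
  with pairwise disjoint supports, an order ideal as required amounts to a choice of one leading term
  in every element of degree 7 such that each term of degree 8 has a child that is not chosen;
  linear independence and spanning are then automatic. The leading term of \<open>t\<^sub>L + t\<^sub>L\<^sub>'\<close>, for a literal
  \<open>L\<close> and its negation \<open>L'\<close>, corresponds to the false one of the two literals, that of a clause
  polynomial to a literal satisfying the clause. All children of \<open>t\<^sub>L\<cdot>x\<close>, where \<open>x\<close> has subscript \<open>c\<^sub>l\<close> and \<open>L\<close> is in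
  clause \<open>l\<close>, except \<open>t\<^sub>L\<close> and \<open>t\<^sub>L\<cdot>x/c\<^sub>l\<close> are forced to be chosen by \<open>F\<^sub>2\<close>. So the condition on \<open>t\<^sub>L\<cdot>x\<close> says
  that a literal chosen for a clause is not false, and every other term of degree 8 has a child
  that is never a leading term.
\<close>

abbreviation (input) lookup where "lookup \<equiv> Poly_Mapping.lookup"
abbreviation (input) keys where "keys \<equiv> Poly_Mapping.keys"

subsection \<open>Degrees of terms\<close>

lemma lookup_ind: "lookup (ind y) z = (if y = z then 1 else 0)"
  by (simp add: ind_def lookup_single when_def)

lemma total_degree_add: "total_degree (s + t) = total_degree s + total_degree t"
  by (simp add: total_degree_def lookup_add sum.distrib)

lemma total_degree_ind [simp]: "total_degree (ind y) = 1"
  by (simp add: total_degree_def lookup_ind)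

lemma total_degree_eq_0_iff: "total_degree t = 0 \<longleftrightarrow> t = 0"
  by (auto simp: total_degree_def poly_mapping_eq_iff fun_eq_iff)

lemma add_ind_minus_ind: "0 < lookup t y \<Longrightarrow> t - ind y + ind y = t"
  by (rule poly_mapping_eqI) (auto simp: lookup_add lookup_minus lookup_ind)

lemma obtain_child:
  assumes "0 < lookup t y"
  obtains s where "s + ind y = t"
  using add_ind_minus_ind[OF assms] that by blast

lemma ex_lookup_pos: "0 < total_degree t \<Longrightarrow> \<exists>y. 0 < lookup t y"
  unfolding total_degree_def by (metis gr_zeroI sum.neutral)

text \<open>A bound on the degree bounds every exponent, and over finitely many indeterminates only
  finitely many exponent functions have values in \<open>{..d}\<close>.\<close>

lemma finite_total_degree_le: "finite {t :: 'v::finite pterm. total_degree t \<le> d}"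
proof -
  have "lookup ` {t :: 'v pterm. total_degree t \<le> d} \<subseteq> {f. \<forall>y. f y \<in> {..d}}"
  proof clarsimp
    fix t :: "'v pterm" and y
    assume "total_degree t \<le> d"
    moreover have "lookup t y \<le> total_degree t"
      unfolding total_degree_def by (rule member_le_sum) auto
    ultimately show "lookup t y \<le> d" by simp
  qed
  moreover have "finite {f :: 'v \<Rightarrow> nat. \<forall>y. f y \<in> {..d}}"
    using finite_set_of_finite_funs[of "UNIV :: 'v set" "{..d}" 0] by simp
  ultimately show ?thesis
    by (meson finite_imageD finite_subset inj_onI lookup_inject)
qed

text \<open>Indeterminates are divided out one at a time. In \<open>border_basis_criterion\<close>
  this puts every term of degree above \<open>d\<close> into the ideal.\<close>

lemma ex_factor_of_degree: "d \<le> total_degree t \<Longrightarrow> \<exists>s u. t = s + u \<and> total_degree s = d"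
proof (induction "total_degree t - d" arbitrary: t)
  case 0
  then show ?case by (metis add.right_neutral diff_is_0_eq le_antisym)
next
  case (Suc n)
  then obtain y where "0 < lookup t y"
    using ex_lookup_pos[of t] by fastforce
  then obtain t' where t': "t' + ind y = t"
    by (rule obtain_child)
  then have "total_degree t = Suc (total_degree t')"
    using total_degree_add[of t' "ind y"] by simp
  then have "n = total_degree t' - d" "d \<le> total_degree t'"
    using Suc.hyps(2) by linarith+
  then obtain s u where "t' = s + u" "total_degree s = d"
    using Suc.hyps(1) by blast
  then show ?case using t' by (metis add.assoc)
qed


subsection \<open>Border bases of ideals containing all terms of some degree\<close>

lemma lookup_lincomb: "finite T \<Longrightarrow> lookup (lincomb T a) t = (if t \<in> T then a t else 0)"
  by (simp add: lincomb_def lookup_sum lookup_single when_def)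

lemma lincomb_add: "lincomb T (\<lambda>t. a t + b t) = lincomb T a + lincomb T b"
  by (simp add: lincomb_def single_add sum.distrib)

lemma border_not_mem: "b \<in> border T \<Longrightarrow> b \<notin> T"
  by (simp add: border_def)

lemma keys_mon [simp]: "keys (mon t :: ('v, 'k::field) mpoly) = {t}"
  by (simp add: mon_def)

text \<open>The coefficients in \<open>border_prebasis\<close> can be read off the polynomials, up
  to sign. So a prebasis can be recognised from supports and leading coefficients.\<close>

lemma border_prebasis_iff:
  fixes G :: "('v::finite, 'k::field) mpoly set"
  assumes "finite T"
  shows "border_prebasis T G \<longleftrightarrow>
    (\<exists>g. G = g ` border T \<and> (\<forall>b\<in>border T. lookup (g b) b = 1 \<and> keys (g b) \<subseteq> insert b T))"
proof
  assume "border_prebasis T G"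
  then obtain a where "G = (\<lambda>b. mon b - lincomb T (a b)) ` border T"
    by (auto simp: border_prebasis_def)
  then show "\<exists>g. G = g ` border T \<and> (\<forall>b\<in>border T. lookup (g b) b = 1 \<and> keys (g b) \<subseteq> insert b T)"
    using assms
    by (auto dest: border_not_mem intro!: exI[of _ "\<lambda>b. mon b - lincomb T (a b)"]
        simp: in_keys_iff lookup_minus lookup_lincomb mon_def lookup_single when_def split: if_splits)
next
  assume "\<exists>g. G = g ` border T \<and> (\<forall>b\<in>border T. lookup (g b) b = 1 \<and> keys (g b) \<subseteq> insert b T)"
  then obtain g where g: "G = g ` border T"
    "\<And>b. b \<in> border T \<Longrightarrow> lookup (g b) b = 1"
    "\<And>b. b \<in> border T \<Longrightarrow> keys (g b) \<subseteq> insert b T" by blast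
  have "g b = mon b - lincomb T (\<lambda>t. - lookup (g b) t)" if b: "b \<in> border T" for b
  proof (rule poly_mapping_eqI)
    fix t
    show "lookup (g b) t = lookup (mon b - lincomb T (\<lambda>t. - lookup (g b) t)) t"
      using g(2,3)[OF b] border_not_mem[OF b] assms
      by (auto simp: lookup_minus lookup_lincomb mon_def lookup_single when_def in_keys_iff subset_iff)
  qed
  then show "border_prebasis T G"
    unfolding border_prebasis_def g(1)
    by (intro exI[of _ "\<lambda>b t. - lookup (g b) t"]) (auto simp: image_def)
qed

section \<open>Ideals, residue classes and products in lowest degree\<close>

interpretation ring_module: module "(*) :: 'a::comm_ring_1 \<Rightarrow> 'a \<Rightarrow> 'a"
  by standard (auto simp: algebra_simps)

lemma residue_class_eq_iff:
  assumes "is_ideal I"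
  shows "residue_class I p = residue_class I q \<longleftrightarrow> p - q \<in> I"
proof
  have "p + 0 \<in> residue_class I p"
    using assms unfolding residue_class_def is_ideal_def by (blast intro: ring_module.subspace_0)
  moreover assume "residue_class I p = residue_class I q"
  ultimately have "p \<in> residue_class I q" by simp
  then obtain r where "p = q + r" "r \<in> I"
    by (auto simp: residue_class_def)
  then show "p - q \<in> I" by simp
next
  assume pq: "p - q \<in> I"
  then have "q - p \<in> I"
    using assms ring_module.subspace_neg unfolding is_ideal_def by (metis minus_diff_eq)
  have "\<exists>r'\<in>I. p + r = q + r'" if "r \<in> I" for r
    using ring_module.subspace_add[OF assms[unfolded is_ideal_def] pq that]
    by (intro bexI[of _ "p - q + r"]) auto
  moreover have "\<exists>r'\<in>I. q + r = p + r'" if "r \<in> I" for r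
    using ring_module.subspace_add[OF assms[unfolded is_ideal_def] \<open>q - p \<in> I\<close> that]
    by (intro bexI[of _ "q - p + r"]) auto
  ultimately show "residue_class I p = residue_class I q"
    unfolding residue_class_def by blast
qed

lemma mult_mem_ideal:
  assumes "is_ideal I" "p \<in> I" shows "q * p \<in> I"
  using assms ring_module.subspace_scale by (auto simp: is_ideal_def)

lemma poly_mapping_sum_single: "(\<Sum>t\<in>keys p. Poly_Mapping.single t (lookup p t)) = p"
proof (rule poly_mapping_eqI)
  fix k
  show "lookup (\<Sum>t\<in>keys p. Poly_Mapping.single t (lookup p t)) k = lookup p k"
    by (cases "k \<in> keys p")
      (auto simp: lookup_sum lookup_single when_def in_keys_iff)
qed

text \<open>\<open>0\<close> is the term 1, so multiplying by a polynomial without constant term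
  strictly raises the least degree.\<close>

lemma keys_mult_above_degree:
  fixes p q :: "('v::finite, 'k::field) mpoly"
  assumes "0 \<notin> keys q" "\<And>t. t \<in> keys p \<Longrightarrow> d \<le> total_degree t" "t \<in> keys (q * p)"
  shows "d < total_degree t"
proof -
  obtain a b where ab: "t = a + b" "a \<in> keys q" "b \<in> keys p"
    using keys_mult[of q p] assms(3) by blast
  then have "total_degree a \<noteq> 0"
    using assms(1) total_degree_eq_0_iff by metis
  then show ?thesis
    using ab assms(2)[of b] by (simp add: total_degree_add)
qed

text \<open>Splitting off the constant term of \<open>q\<close> leaves a remainder whose product
  with \<open>p\<close> lives in degrees above \<open>d\<close>.\<close>

lemma lookup_mult_low_degree:
  fixes p q :: "('v::finite, 'k::field) mpoly"
  assumes "\<And>t. t \<in> keys p \<Longrightarrow> d \<le> total_degree t" "total_degree t \<le> d"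
  shows "lookup (q * p) t = lookup q 0 * lookup p t"
proof -
  define r where "r = q - Poly_Mapping.single 0 (lookup q 0)"
  have "0 \<notin> keys r"
    by (simp add: r_def in_keys_iff lookup_minus)
  then have "t \<notin> keys (r * p)"
    using keys_mult_above_degree[of r p d t] assms by auto
  then have "lookup (r * p) t = 0"
    by (simp add: in_keys_iff)
  moreover have "q * p = Poly_Mapping.single 0 (lookup q 0) * p + r * p"
    by (simp add: r_def algebra_simps)
  moreover have "lookup (Poly_Mapping.single 0 (lookup q 0) * p) t = lookup q 0 * lookup p t"
    by (simp flip: mult_map_scale_conv_mult add: Poly_Mapping.map.rep_eq when_def)
  ultimately show ?thesis by (simp add: lookup_add)
qed

text \<open>
  The set \<open>W\<close> of polynomials whose reduction by the \<open>g b\<close> vanishes in degrees at most \<open>d\<close> is an ideal: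
  its elements have no terms of degree less than \<open>d\<close>, so multiplication by \<open>q\<close> acts on their
  components of degree \<open>d\<close> as the scalar \<open>q(0)\<close>.
\<close>

lemma reduced_eq_zero:
  fixes G :: "('v::finite, 'k::field) mpoly set"
  assumes low: "\<And>t. total_degree t < d \<Longrightarrow> t \<in> T"
    and le: "\<And>t. t \<in> T \<Longrightarrow> total_degree t \<le> d"
    and B: "finite B" "\<And>b. b \<in> B \<Longrightarrow> total_degree b = d" "B \<inter> T = {}"
    and g: "\<And>b t. b \<in> B \<Longrightarrow> t \<in> keys (g b) \<Longrightarrow> d \<le> total_degree t"
    and G: "\<And>p. p \<in> G \<Longrightarrow> (\<forall>t\<in>keys p. d < total_degree t) \<or>
      (\<exists>b\<in>B. p = g b \<and> lookup p b = 1 \<and> keys p \<subseteq> insert b T)"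
    and p: "p \<in> ideal_generated G" "keys p \<subseteq> T"
  shows "p = 0"
proof -
  define W where "W = {p. \<forall>t\<in>T. lookup p t = (\<Sum>b\<in>B. lookup p b * lookup (g b) t)}"
  have W: "lookup p t = (\<Sum>b\<in>B. lookup p b * lookup (g b) t)" if "p \<in> W" "t \<in> T" for p t
    using that unfolding W_def by blast
  have W_low: "d \<le> total_degree t" if "p \<in> W" "t \<in> keys p" for p t
  proof (rule ccontr)
    assume "\<not> ?thesis"
    then have "t \<in> T" "\<And>b. b \<in> B \<Longrightarrow> lookup (g b) t = 0"
      using low g by (auto simp: in_keys_iff)
    then have "lookup p t = 0"
      using W[OF that(1), of t] by simp
    then show False using that by (simp add: in_keys_iff)
  qed
  have "ring_module.span G \<subseteq> W"
  proof (rule ring_module.span_minimal)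
    show "ring_module.subspace W"
    proof (rule ring_module.subspaceI)
      fix q p assume p: "p \<in> W"
      have low: "lookup (q * p) t = lookup q 0 * lookup p t" if "total_degree t \<le> d" for t
        by (rule lookup_mult_low_degree[OF W_low[OF p] that])
      have "lookup (q * p) t = (\<Sum>b\<in>B. lookup (q * p) b * lookup (g b) t)" if "t \<in> T" for t
      proof -
        have "lookup (q * p) t = lookup q 0 * (\<Sum>b\<in>B. lookup p b * lookup (g b) t)"
          unfolding low[OF le[OF that]] by (rule arg_cong[OF W[OF p that]])
        also have "\<dots> = (\<Sum>b\<in>B. lookup (q * p) b * lookup (g b) t)"
        proof (subst sum_distrib_left, rule sum.cong[OF refl])
          fix b assume "b \<in> B"
          then have "total_degree b \<le> d" using B(2) by simp
          then show "lookup q 0 * (lookup p b * lookup (g b) t) = lookup (q * p) b * lookup (g b) t"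
            unfolding low[OF \<open>total_degree b \<le> d\<close>] by (simp only: mult.assoc)
        qed
        finally show ?thesis .
      qed
      then show "q * p \<in> W" by (simp add: W_def)
    qed (auto simp: W_def lookup_add sum.distrib distrib_right)
  next
    show "G \<subseteq> W"
    proof
      fix p assume "p \<in> G"
      from G[OF this] show "p \<in> W"
      proof
        assume *: "\<forall>t\<in>keys p. d < total_degree t"
        then have "lookup p t = 0" if "total_degree t \<le> d" for t
          using that by (metis in_keys_iff not_le)
        then show "p \<in> W" using B(2) le by (simp add: W_def)
      next
        assume "\<exists>b\<in>B. p = g b \<and> lookup p b = 1 \<and> keys p \<subseteq> insert b T"
        then obtain b where b: "b \<in> B" "p = g b" "lookup p b = 1" "keys p \<subseteq> insert b T" by blast
        \<comment> \<open>Since \<open>B\<close> is disjoint from \<open>T\<close>, the support of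
          \<open>p\<close> meets \<open>B\<close> only in \<open>b\<close>, and the sum collapses to
          one summand.\<close>
        then have "lookup p b' = (if b' = b then 1 else 0)" if "b' \<in> B" for b'
          using that B(3) by (auto simp: in_keys_iff)
        then have "(\<Sum>b'\<in>B. lookup p b' * lookup (g b') t)
            = (\<Sum>b'\<in>B. if b' = b then lookup (g b') t else 0)" for t
          by (intro sum.cong) auto
        then show "p \<in> W"
          using b(1,2) B(1) by (simp add: W_def)
      qed
    qed
  qed
  then have pW: "p \<in> W" using p(1) by (auto simp: ideal_generated_def)
  \<comment> \<open>A support inside \<open>T\<close> makes the right-hand side of the equation
    defining \<open>W\<close> vanish.\<close>
  have "lookup p b = 0" if "b \<in> B" for b
    using that p(2) B(3) by (auto simp: in_keys_iff)
  then have "lookup p t = 0" if "t \<in> T" for t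
    using W[OF pW that] by simp
  then show "p = 0"
    using p(2) by (intro poly_mapping_eqI) (auto simp: in_keys_iff)
qed

text \<open>Turns the border basis property into conditions on supports. Disjoint supports match
  generators with border terms one to one. Independence comes from \<open>reduced_eq_zero\<close>.
  For spanning, a term lies in \<open>T\<close>, or has degree above \<open>d\<close> and lies in
  the ideal, or is a border term of degree \<open>d\<close> and is reduced by its generator.\<close>

lemma border_basis_criterion:
  fixes G :: "('v::finite, 'k::field) mpoly set"
  assumes low: "\<And>t. total_degree t < d \<Longrightarrow> t \<in> T"
    and le: "\<And>t. t \<in> T \<Longrightarrow> total_degree t \<le> d"
    and G_low: "\<And>p t. p \<in> G \<Longrightarrow> t \<in> keys p \<Longrightarrow> d \<le> total_degree t"
    and G_high: "\<And>t. total_degree t = Suc d \<Longrightarrow> mon t \<in> G"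
    and lead: "\<And>p. p \<in> G \<Longrightarrow> \<exists>b\<in>border T. lookup p b = 1 \<and> keys p \<subseteq> insert b T"
    and covers: "\<And>b. b \<in> border T \<Longrightarrow> \<exists>p\<in>G. b \<in> keys p"
    and disjoint: "\<And>p q t. p \<in> G \<Longrightarrow> q \<in> G \<Longrightarrow> t \<in> keys p \<Longrightarrow> t \<in> keys q \<Longrightarrow> p = q"
  shows "border_basis T G (ideal_generated G)"
proof -
  let ?I = "ideal_generated G"
  have finT: "finite T"
    using finite_total_degree_le[of d] le by (metis (lifting) finite_subset mem_Collect_eq subsetI)
  have ideal: "is_ideal ?I"
    by (simp add: is_ideal_def ideal_generated_def)
  have GI: "G \<subseteq> ?I"
    by (simp add: ideal_generated_def ring_module.span_superset)
  obtain g where g: "\<And>b. b \<in> border T \<Longrightarrow> g b \<in> G \<and> b \<in> keys (g b)"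
    using covers by metis
  have g_eq: "g b = p" if "p \<in> G" "b \<in> border T" "b \<in> keys p" for p b
    using disjoint g that by blast
  \<comment> \<open>The term supplied by \<open>lead\<close> must be \<open>b\<close> itself,
    because \<open>b\<close> is in the support of \<open>g b\<close> but not in
    \<open>T\<close>.\<close>
  have g_lead: "lookup (g b) b = 1 \<and> keys (g b) \<subseteq> insert b T" if "b \<in> border T" for b
    using lead[of "g b"] g[OF that] border_not_mem[OF that] by auto
  have G_image: "\<exists>b\<in>border T. p = g b" if "p \<in> G" for p
    using lead[OF that] g_eq[OF that] by (metis in_keys_iff zero_neq_one)
  then have "G = g ` border T" using g by auto
  then have pre: "border_prebasis T G"
    using g_lead finT border_prebasis_iff by blast
  define B where "B = {b \<in> border T. total_degree b = d}"
  have finB: "finite B"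
    by (rule finite_subset[OF _ finite_total_degree_le[of d]]) (auto simp: B_def)
  have G_split: "(\<forall>t\<in>keys p. d < total_degree t) \<or>
      (\<exists>b\<in>B. p = g b \<and> lookup p b = 1 \<and> keys p \<subseteq> insert b T)" if p: "p \<in> G" for p
  proof -
    obtain b where b: "b \<in> border T" "p = g b" "b \<in> keys p"
      using G_image[OF p] g by blast
    show ?thesis
    proof (cases "b \<in> B")
      case True
      then show ?thesis using b(2) g_lead[OF b(1)] by blast
    next
      case False
      \<comment> \<open>A border term outside \<open>B\<close> has degree exactly
        \<open>Suc d\<close>, so \<open>mon b\<close> is a generator sharing \<open>b\<close> with
        \<open>p\<close>, and disjointness gives \<open>p = mon b\<close>.\<close>
      obtain y s where "b = ind y + s" "s \<in> T"
        using b(1) by (auto simp: border_def)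
      then have "total_degree b \<le> Suc d"
        using le[of s] by (simp add: total_degree_add)
      then have "total_degree b = Suc d"
        using False b p G_low[of p b] by (simp add: B_def le_antisym le_Suc_eq)
      moreover from this have "p = mon b"
        using g_eq[of "mon b" b] G_high b by auto
      ultimately show ?thesis by simp
    qed
  qed
  have indep: "\<forall>t\<in>T. a t = 0" if "residue_class ?I (lincomb T a) = residue_class ?I 0" for a
  proof -
    have "lincomb T a \<in> ?I"
      using that residue_class_eq_iff[OF ideal] by simp
    moreover have "keys (lincomb T a) \<subseteq> T"
      using finT by (auto simp: in_keys_iff lookup_lincomb split: if_splits)
    moreover have "\<And>b. b \<in> B \<Longrightarrow> total_degree b = d" "B \<inter> T = {}"
      "\<And>b t. b \<in> B \<Longrightarrow> t \<in> keys (g b) \<Longrightarrow> d \<le> total_degree t"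
      using g G_low by (auto simp: B_def dest: border_not_mem)
    ultimately have "lincomb T a = 0"
      by (intro reduced_eq_zero[OF low le finB _ _ _ G_split]) auto
    then show ?thesis
      using lookup_lincomb[OF finT, of a] by (metis lookup_zero)
  qed
  have span_single: "\<exists>a. Poly_Mapping.single t v - lincomb T a \<in> ?I" for t v
  proof -
    have zero: "\<exists>a. Poly_Mapping.single t v - lincomb T a \<in> ?I"
      if "Poly_Mapping.single t v \<in> ?I"
      using that by (intro exI[of _ "\<lambda>_. 0"]) (simp add: lincomb_def)
    consider "t \<in> T" | "d < total_degree t" | "t \<notin> T" "total_degree t = d"
      using low nat_neq_iff by blast
    then show ?thesis
    proof cases
      case 1
      then have "Poly_Mapping.single t v = lincomb T (\<lambda>s. if s = t then v else 0)"
        using finT by (intro poly_mapping_eqI) (auto simp: lookup_lincomb lookup_single when_def)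
      then show ?thesis
        using ideal ring_module.subspace_0 unfolding is_ideal_def by (metis diff_self)
    next
      case 2
      then obtain s u where su: "t = s + u" "total_degree s = Suc d"
        using ex_factor_of_degree[of "Suc d" t] by auto
      then have "Poly_Mapping.single u v * mon s \<in> ?I"
        using mult_mem_ideal[OF ideal] GI G_high by blast
      then show ?thesis
        using su zero by (simp add: mon_def mult_single add.commute)
    next
      case 3
      show ?thesis
      proof (cases "t \<in> border T")
        case True
        \<comment> \<open>Chosen so that the difference becomes \<open>v\<close> times the generator
          belonging to \<open>t\<close>.\<close>
        define a where "a = (\<lambda>s. - v * lookup (g t) s)"
        have "Poly_Mapping.single t v - lincomb T a = Poly_Mapping.single 0 v * g t"
          using g_lead[OF True] border_not_mem[OF True] finT
          by (intro poly_mapping_eqI)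
            (auto simp: a_def lookup_minus lookup_lincomb lookup_single when_def subset_iff in_keys_iff
              Poly_Mapping.map.rep_eq simp flip: mult_map_scale_conv_mult)
        then show ?thesis
          using mult_mem_ideal[OF ideal] g[OF True] GI by (metis subsetD)
      next
        case False
        show ?thesis
        proof (cases "d = 0")
          \<comment> \<open>Here \<open>t\<close> is the term 1 and has no child. But then
            \<open>T\<close> and its border are empty, while \<open>lead\<close> demands a border
            term for the generator given by any single indeterminate.\<close>
          case True
          then have t0: "t = 0" using 3 total_degree_eq_0_iff by auto
          have "T = {}"
            using le 3(1) t0 True total_degree_eq_0_iff by (metis equals0I le_zero_eq)
          then show ?thesis
            using lead[OF G_high[of "ind undefined"]] True by (simp add: border_def)
        next
          case d: False
          then obtain y where "0 < lookup t y"
            using ex_lookup_pos[of t] 3(2) by (metis gr0I)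
          then obtain s where s: "s + ind y = t"
            by (rule obtain_child)
          then have "s \<in> T"
            using low[of s] 3 d total_degree_add[of s "ind y"] by simp
          then have "t \<in> border T"
            using s 3 unfolding border_def by (auto simp: add.commute)
          with False show ?thesis by simp
        qed
      qed
    qed
  qed
  have span: "\<exists>a. p - lincomb T a \<in> ?I" for p
  proof -
    have "\<forall>t. \<exists>a. Poly_Mapping.single t (lookup p t) - lincomb T a \<in> ?I"
      using span_single by blast
    from choice[OF this] obtain a
      where a: "\<And>t. Poly_Mapping.single t (lookup p t) - lincomb T (a t) \<in> ?I" by blast
    have "(\<Sum>t\<in>keys p. Poly_Mapping.single t (lookup p t) - lincomb T (a t)) \<in> ?I"
      by (intro ring_module.subspace_sum[OF ideal[unfolded is_ideal_def]] a)
    moreover have "(\<Sum>t\<in>A. lincomb T (a t)) = lincomb T (\<lambda>s. \<Sum>t\<in>A. a t s)" if "finite A" for A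
      using that by induction (simp_all add: lincomb_add, simp add: lincomb_def)
    ultimately show ?thesis
      by (auto simp: sum_subtractf poly_mapping_sum_single)
  qed
  show ?thesis
    unfolding border_basis_def residue_classes_basis_def
  proof (intro conjI allI impI)
    show "\<exists>a. residue_class ?I p = residue_class ?I (lincomb T a)" for p
      unfolding residue_class_eq_iff[OF ideal] by (rule span)
  qed (use pre ideal GI indep in blast)+
qed


subsection \<open>Terms constructed from an instance\<close>

lemma lookup_t_C:
  "lookup (t_C cl i) y = (case y of Cl j \<Rightarrow> if j \<in> occurrences cl i then 1 else 0
     | BigX \<Rightarrow> 4 - card (occurrences cl i) | _ \<Rightarrow> 0)"
  by (auto simp: t_C_def lookup_add lookup_sum lookup_ind lookup_single when_def split: indet.split)

lemma lookup_t_lit: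
  "lookup (t_lit cl L) y = (case y of
       Xp j \<Rightarrow> if j = variable_of L then (case L of Pos _ \<Rightarrow> 1 | Neg _ \<Rightarrow> 2) else 0
     | Xn j \<Rightarrow> if j = variable_of L then (case L of Pos _ \<Rightarrow> 2 | Neg _ \<Rightarrow> 1) else 0
     | Xc _ \<Rightarrow> 0
     | _ \<Rightarrow> lookup (t_C cl (variable_of L)) y)"
  by (cases L) (auto simp: lookup_add lookup_ind lookup_t_C split: indet.split)

lemma mem_occurrences: "L \<in> cl l \<Longrightarrow> l \<in> occurrences cl (variable_of L)"
  by (cases L) (auto simp: occurrences_def)

text \<open>The \<open>x\<close>-indeterminates contribute 3 and \<open>t_C\<close> contributes 4:
  at most four occurrences make the truncated exponent of \<open>BigX\<close> exact.\<close>

lemma total_degree_t_lit: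
  fixes cl :: "'m::finite \<Rightarrow> 'n::finite literal set"
  assumes "is_34SAT cl"
  shows "total_degree (t_lit cl L) = 7"
proof -
  have "total_degree (\<Sum>j\<in>A. ind (Cl j) :: ('n, 'm) indet pterm) = card A" for A
    by (induction A rule: infinite_finite_induct) (auto simp: total_degree_add total_degree_eq_0_iff)
  moreover have "total_degree (Poly_Mapping.single BigX k :: ('n, 'm) indet pterm) = k" for k
    by (simp add: total_degree_def lookup_single when_def)
  ultimately have "total_degree (t_C cl i) = 4" for i
    using assms by (simp add: t_C_def total_degree_add is_34SAT_def)
  then show ?thesis by (cases L) (simp_all add: total_degree_add)
qed

lemma t_clause_add_ind:
  assumes "L \<in> cl l"
  shows "t_clause cl L l + ind (Cl l) = t_lit cl L + ind (Xc l)"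
  unfolding t_clause_def using mem_occurrences[where cl = cl, OF assms]
  by (intro add_ind_minus_ind) (simp add: lookup_add lookup_t_lit lookup_t_C)

lemma total_degree_t_clause:
  assumes "is_34SAT cl" "L \<in> cl l"
  shows "total_degree (t_clause cl L l) = 7"
  using arg_cong[OF t_clause_add_ind[where cl = cl, OF assms(2)], of total_degree]
    total_degree_t_lit[OF assms(1)]
  by (simp add: total_degree_add)

declare t_lit.simps [simp del]

lemma lookup_t_clause:
  "lookup (t_clause cl L l) y =
    lookup (t_lit cl L) y + (if y = Xc l then 1 else 0) - (if y = Cl l then 1 else 0)"
  by (auto simp: t_clause_def lookup_minus lookup_add lookup_ind)

text \<open>The indeterminate with exponent 2 in \<open>t\<^sub>L\<close>, by which \<open>L\<close> can be recovered from \<open>t\<^sub>L\<close>.\<close>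

primrec double_indet :: "'n literal \<Rightarrow> ('n, 'm) indet" where
  "double_indet (Pos i) = Xn i"
| "double_indet (Neg i) = Xp i"

lemma lookup_double_indet: "lookup (t_lit cl L') (double_indet L) = 2 \<longleftrightarrow> L' = L"
  by (cases L; cases L') (auto simp: lookup_t_lit)

lemma double_indet_simps [simp]: "double_indet L \<noteq> Xc l" "Xc l \<noteq> double_indet L" "double_indet L \<noteq> Cl l"
  by (cases L; simp)+

lemma t_lit_inject: "t_lit cl L = t_lit cl L' \<longleftrightarrow> L = L'"
  by (metis lookup_double_indet)

text \<open>Replacing \<open>Cl l\<close> by \<open>Xc l\<close> leaves the exponent of
  \<open>double_indet L\<close> alone, so \<open>L\<close> is still visible; \<open>l\<close> is
  visible in the exponent of \<open>Xc l\<close>.\<close>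

lemma t_clause_inject: "t_clause cl L l = t_clause cl L' l' \<longleftrightarrow> L = L' \<and> l = l'"
proof
  assume eq: "t_clause cl L l = t_clause cl L' l'"
  from arg_cong[OF this, of "\<lambda>t. lookup t (double_indet L)"]
  have "lookup (t_lit cl L') (double_indet L) = lookup (t_lit cl L) (double_indet L)"
    by (simp add: lookup_t_clause)
  then have "L = L'" by (metis lookup_double_indet)
  moreover have "l = l'"
    using arg_cong[OF eq, of "\<lambda>t. lookup t (Xc l)"]
    by (simp add: lookup_t_clause lookup_t_lit split: if_splits)
  ultimately show "L = L' \<and> l = l'" ..
qed simp

lemma t_clause_neq_t_lit: "t_clause cl L l \<noteq> t_lit cl L'"
proof
  assume "t_clause cl L l = t_lit cl L'"
  from arg_cong[OF this, of "\<lambda>t. lookup t (Xc l)"] show False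
    by (simp add: lookup_t_clause lookup_t_lit)
qed

section \<open>The terms of \<open>F_2\<close> and the children they do not cover\<close>

lemma mem_K_var:
  "t \<in> K_var cl i \<longleftrightarrow>
    (\<exists>L. variable_of L = i \<and> (t = t_lit cl L \<or> (\<exists>l. L \<in> cl l \<and> t = t_clause cl L l)))"
proof -
  have all: "(\<exists>L. variable_of L = i \<and> Q L) \<longleftrightarrow> Q (Pos i) \<or> Q (Neg i)" for Q
    by (metis literal.exhaust variable_of.simps)
  show ?thesis unfolding all K_var_def K_lit_def by auto
qed

lemma mem_R_var:
  "t \<in> R_var cl i \<longleftrightarrow>
    (\<exists>L l y. variable_of L = i \<and> L \<in> cl l \<and> t + ind y = t_lit cl L + ind (Xc l))"
proof -
  have all: "(\<exists>L. variable_of L = i \<and> Q L) \<longleftrightarrow> Q (Pos i) \<or> Q (Neg i)" for Q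
    by (metis literal.exhaust variable_of.simps)
  have "(\<exists>L l y. variable_of L = i \<and> L \<in> cl l \<and> t + ind y = t_lit cl L + ind (Xc l)) \<longleftrightarrow>
      (\<exists>L. variable_of L = i \<and> (\<exists>l y. L \<in> cl l \<and> t + ind y = t_lit cl L + ind (Xc l)))" by blast
  then show ?thesis unfolding all R_var_def P_var_def P_lit_def children_def by auto
qed

text \<open>A member of \<open>R_var cl i\<close> contains only \<open>x\<close>-indeterminates of
  the variable \<open>i\<close>. This excludes that a term removed through \<open>K_var\<close> for
  its own variable re-enters \<open>F2_terms\<close> through another one.\<close>

lemma R_var_variable:
  assumes "t \<in> R_var cl i" "variable_of L = j"
    and "\<And>y. y \<in> {Xp j, Xn j} \<Longrightarrow> lookup t y = lookup (t_lit cl L) y"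
  shows "i = j"
proof -
  obtain L' l y where *: "variable_of L' = i" "t + ind y = t_lit cl L' + ind (Xc l)"
    using assms(1) by (auto simp: mem_R_var)
  have "lookup (t + ind y) (Xp j) = lookup (t_lit cl L') (Xp j)"
    using *(2) by (simp add: lookup_add lookup_ind)
  moreover have "0 < lookup t (Xp j)"
    using assms(2,3) by (cases L) (auto simp: lookup_t_lit)
  ultimately show "i = j"
    using *(1) by (auto simp: lookup_add lookup_t_lit split: if_splits)
qed

definition F2_terms :: "('m::finite \<Rightarrow> 'n literal set) \<Rightarrow> ('n, 'm) indet pterm set" where
  "F2_terms cl = (\<Union>i. R_var cl i - K_var cl i)"

lemma t_lit_notin_F2_terms: "t_lit cl L \<notin> F2_terms cl"
proof
  assume "t_lit cl L \<in> F2_terms cl"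
  then obtain i where *: "t_lit cl L \<in> R_var cl i" "t_lit cl L \<notin> K_var cl i"
    by (auto simp: F2_terms_def)
  have "i = variable_of L"
    by (rule R_var_variable[OF *(1)]) auto
  then show False
    using *(2) unfolding mem_K_var by blast
qed

lemma t_clause_notin_F2_terms:
  assumes "L \<in> cl l" shows "t_clause cl L l \<notin> F2_terms cl"
proof
  assume "t_clause cl L l \<in> F2_terms cl"
  then obtain i where *: "t_clause cl L l \<in> R_var cl i" "t_clause cl L l \<notin> K_var cl i"
    by (auto simp: F2_terms_def)
  have "i = variable_of L"
    by (rule R_var_variable[OF *(1)]) (auto simp: lookup_t_clause)
  then show False
    using *(2) assms unfolding mem_K_var by blast
qed

lemma total_degree_F2_terms:
  fixes cl :: "'m::finite \<Rightarrow> 'n::finite literal set"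
  assumes "is_34SAT cl" "t \<in> F2_terms cl"
  shows "total_degree t = 7"
proof -
  obtain L l y where "t + ind y = t_lit cl L + ind (Xc l)"
    using assms(2) by (auto simp: F2_terms_def mem_R_var)
  from arg_cong[OF this, of total_degree] show ?thesis
    using total_degree_t_lit[OF assms(1)] by (simp add: total_degree_add)
qed

text \<open>A child obtained by removing anything but \<open>Xc l\<close> or \<open>Cl l\<close> has
  exponent 1 in both. No member of \<open>K_var\<close> does: \<open>t_lit\<close> lacks
  \<open>Xc l\<close>, and a \<open>t_clause\<close> containing \<open>Xc l\<close> has lost
  \<open>Cl l\<close>.\<close>

lemma child_of_P_term:
  assumes "L \<in> cl l" "s + ind y = t_lit cl L + ind (Xc l)"
  shows "s = t_lit cl L \<or> s = t_clause cl L l \<or> s \<in> F2_terms cl"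
proof (cases "y = Xc l \<or> y = Cl l")
  case True
  then show ?thesis
    using assms t_clause_add_ind by (metis add_right_cancel)
next
  case False
  have look: "lookup s (Xc l) = 1" "lookup s (Cl l) = 1"
    using arg_cong[OF assms(2), of "\<lambda>t. lookup t (Xc l)"]
      arg_cong[OF assms(2), of "\<lambda>t. lookup t (Cl l)"] False mem_occurrences[where cl = cl, OF assms(1)]
    by (simp_all add: lookup_add lookup_ind lookup_t_lit lookup_t_C)
  have "s \<notin> K_var cl (variable_of L)"
  proof
    assume "s \<in> K_var cl (variable_of L)"
    then consider L' where "s = t_lit cl L'" | L' l' where "L' \<in> cl l'" "s = t_clause cl L' l'"
      by (auto simp: mem_K_var)
    then show False
    proof cases
      case 1
      then show False using look(1) by (simp add: lookup_t_lit)
    next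
      case 2
      then have "l' = l"
        using look(1) by (simp add: lookup_t_clause lookup_t_lit split: if_splits)
      then show False
        using 2 look(2) by (simp add: lookup_t_clause lookup_t_lit lookup_t_C split: if_splits)
    qed
  qed
  moreover have "s \<in> R_var cl (variable_of L)"
    using assms unfolding mem_R_var by blast
  ultimately show ?thesis by (auto simp: F2_terms_def)
qed


subsection \<open>The polynomials\<close>

lemma F_all_cases:
  fixes cl :: "'m::finite \<Rightarrow> 'n::finite literal set"
  assumes "p \<in> (F_all cl :: (('n, 'm) indet, 'k::field) mpoly set)" "t \<in> keys p"
  obtains (lit) L where "t = t_lit cl L"
      "p = mon (t_lit cl (Pos (variable_of L))) + mon (t_lit cl (Neg (variable_of L)))"
  | (clause) L l where "L \<in> cl l" "t = t_clause cl L l" "p = (\<Sum>L\<in>cl l. mon (t_clause cl L l))"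
  | (mon_8) "total_degree t = 8" "p = mon t"
  | (mon_F2) "t \<in> F2_terms cl" "p = mon t"
proof -
  consider "p \<in> F_v cl" | "p \<in> F_c cl" | "p \<in> F_1" | "p \<in> F_2 cl"
    using assms(1) by (auto simp: F_all_def)
  then show ?thesis
  proof cases
    case 1
    then obtain i where i: "p = mon (t_lit cl (Pos i)) + mon (t_lit cl (Neg i))"
      by (auto simp: F_v_def)
    then have "t = t_lit cl (Pos i) \<or> t = t_lit cl (Neg i)"
      using assms(2) keys_add[of "mon (t_lit cl (Pos i)) :: (('n, 'm) indet, 'k) mpoly" "mon (t_lit cl (Neg i))"]
      by auto
    then show ?thesis using i lit[of "Pos i"] lit[of "Neg i"] by auto
  next
    case 2
    then obtain l where l: "p = (\<Sum>L\<in>cl l. mon (t_clause cl L l))"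
      by (auto simp: F_c_def)
    then have "\<exists>L\<in>cl l. lookup (mon (t_clause cl L l) :: (('n, 'm) indet, 'k) mpoly) t \<noteq> 0"
      using assms(2) by (auto simp: in_keys_iff lookup_sum intro: ccontr)
    then show ?thesis using l clause
      by (auto simp: mon_def lookup_single when_def split: if_splits)
  next
    case 3
    then show ?thesis using assms(2) mon_8 by (auto simp: F_1_def)
  next
    case 4
    then have "t \<in> F2_terms cl \<and> p = mon t"
      using assms(2) by (auto simp: F_2_def F2_terms_def)
    then show ?thesis using mon_F2 by blast
  qed
qed

text \<open>A common term of the same kind fixes the polynomial by injectivity of
  \<open>t_lit\<close> (up to negation, which gives the same polynomial) and of
  \<open>t_clause\<close>. Different kinds are told apart by degree, by the exponent of
  \<open>Xc l\<close>, or by \<open>F2_terms\<close>, except that two monomials with a common term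
  are equal anyway.\<close>

lemma F_all_disjoint:
  fixes cl :: "'m::finite \<Rightarrow> 'n::finite literal set"
  assumes "is_34SAT cl" "p \<in> (F_all cl :: (('n, 'm) indet, 'k::field) mpoly set)" "q \<in> F_all cl"
    and "t \<in> keys p" "t \<in> keys q"
  shows "p = q"
  using assms(2,4)
proof (cases rule: F_all_cases)
  case lit
  with assms(3,5) show ?thesis
    by (cases rule: F_all_cases)
      (auto simp: t_lit_inject total_degree_t_lit[OF assms(1)] t_lit_notin_F2_terms
        t_clause_neq_t_lit)
next
  case clause
  with assms(3,5) show ?thesis
    by (cases rule: F_all_cases)
      (auto simp: t_clause_inject total_degree_t_clause[OF assms(1)] t_clause_notin_F2_terms
        t_clause_neq_t_lit[symmetric])
next
  case mon_8
  with assms(3,5) show ?thesis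
    by (cases rule: F_all_cases)
      (auto simp: total_degree_t_lit[OF assms(1)] total_degree_t_clause[OF assms(1)])
next
  case mon_F2
  with assms(3,5) show ?thesis
    by (cases rule: F_all_cases) (auto simp: t_lit_notin_F2_terms t_clause_notin_F2_terms)
qed

lemma lookup_F_v:
  "lookup (mon (t_lit cl (Pos i)) + mon (t_lit cl (Neg i)) :: (('n::finite, 'm::finite) indet, 'k::field) mpoly)
    (t_lit cl L) = (if variable_of L = i then 1 else 0)"
  by (cases L) (auto simp: lookup_add mon_def lookup_single when_def t_lit_inject)

text \<open>By \<open>t_clause_inject\<close> the summands are distinct terms, so nothing adds up or
  cancels in any characteristic.\<close>

lemma lookup_F_c:
  fixes cl :: "'m::finite \<Rightarrow> 'n::finite literal set"
  assumes "is_34SAT cl" "L \<in> cl l"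
  shows "lookup (\<Sum>L\<in>cl l. mon (t_clause cl L l) :: (('n, 'm) indet, 'k::field) mpoly)
    (t_clause cl L l) = 1"
proof -
  have "finite (cl l)"
    using assms(1) by (metis card.infinite is_34SAT_def zero_neq_numeral)
  then show ?thesis
    using assms(2) by (simp add: lookup_sum mon_def lookup_single when_def t_clause_inject)
qed


subsection \<open>From a border basis to a satisfying assignment\<close>

lemma satisfiable_if_border_prebasis:
  fixes cl :: "'m::finite \<Rightarrow> 'n::finite literal set"
  assumes sat: "is_34SAT cl" and "finite T"
    and F: "border_prebasis T (F_all cl :: (('n, 'm) indet, 'k::field) mpoly set)"
  shows "satisfiable cl"
proof -
  let ?F = "F_all cl :: (('n, 'm) indet, 'k) mpoly set"
  obtain g where g: "?F = g ` border T"
    "\<And>b. b \<in> border T \<Longrightarrow> lookup (g b) b = 1 \<and> keys (g b) \<subseteq> insert b T"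
    using F border_prebasis_iff[OF \<open>finite T\<close>] by metis
  have lead: "\<exists>b\<in>border T. b \<in> keys p \<and> keys p \<subseteq> insert b T" if "p \<in> ?F" for p
  proof -
    obtain b where "b \<in> border T" "p = g b"
      using \<open>p \<in> ?F\<close> unfolding g(1) by blast
    then show ?thesis
      using g(2)[of b] by (auto simp: in_keys_iff intro!: bexI[of _ b])
  qed
  have mon_border: "t \<in> border T" if "mon t \<in> ?F" for t
    using lead[OF that] by auto
  \<comment> \<open>A literal is meant to be false when its \<open>t_lit\<close> is the leading
    term, that is, lies outside \<open>T\<close>.\<close>
  define v where "v i \<longleftrightarrow> t_lit cl (Pos i) \<in> T" for i
  have "\<exists>L\<in>cl l. holds v L" for l
  proof -
    let ?p = "(\<Sum>L\<in>cl l. mon (t_clause cl L l)) :: (('n, 'm) indet, 'k) mpoly"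
    have "?p \<in> ?F" by (auto simp: F_all_def F_c_def)
    then obtain b where b: "b \<in> border T" "b \<in> keys ?p"
      using lead by blast
    from \<open>?p \<in> ?F\<close> b(2) obtain L where L: "L \<in> cl l" "b = t_clause cl L l"
    proof -
      have "\<exists>L\<in>cl l. lookup (mon (t_clause cl L l) :: (('n, 'm) indet, 'k) mpoly) b \<noteq> 0"
        using b(2) by (auto simp: in_keys_iff lookup_sum intro: ccontr)
      then show ?thesis using that
        by (auto simp: mon_def lookup_single when_def split: if_splits)
    qed
    \<comment> \<open>This term of degree 8 is in the border and so has a child in \<open>T\<close>;
      all its children except \<open>t_lit cl L\<close> turn out to be border terms.\<close>
    have "mon (t_lit cl L + ind (Xc l)) \<in> ?F"
      using total_degree_t_lit[OF sat, of L] by (auto simp: F_all_def F_1_def total_degree_add)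
    from mon_border[OF this] obtain s y where s: "s \<in> T" "ind y + s = t_lit cl L + ind (Xc l)"
      by (auto simp: border_def)
    have "s \<notin> F2_terms cl"
    proof
      assume "s \<in> F2_terms cl"
      then have "mon s \<in> ?F" by (auto simp: F_all_def F_2_def F2_terms_def)
      then show False using mon_border s(1) border_not_mem by blast
    qed
    moreover have "s \<noteq> t_clause cl L l"
      using b(1) L(2) s(1) border_not_mem by blast
    ultimately have LT: "t_lit cl L \<in> T"
      using child_of_P_term[where cl = cl, OF L(1)] s by (metis add.commute)
    have "holds v L"
    proof (cases L)
      case (Pos i)
      then show ?thesis using LT by (simp add: v_def)
    next
      case (Neg i)
      let ?q = "mon (t_lit cl (Pos i)) + mon (t_lit cl (Neg i)) :: (('n, 'm) indet, 'k) mpoly"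
      have "?q \<in> ?F" by (auto simp: F_all_def F_v_def)
      then obtain b' where b': "b' \<in> border T" "b' \<in> keys ?q" using lead by blast
      \<comment> \<open>With \<open>t_lit cl (Neg i)\<close> in \<open>T\<close>, the other term of
        \<open>?q\<close> has to be the leading one, which makes \<open>v i\<close> false.\<close>
      have "keys ?q \<subseteq> {t_lit cl (Pos i), t_lit cl (Neg i)}"
        using keys_add[of "mon (t_lit cl (Pos i)) :: (('n, 'm) indet, 'k) mpoly" "mon (t_lit cl (Neg i))"]
        by auto
      then have "t_lit cl (Pos i) \<in> border T"
        using b' LT Neg border_not_mem by blast
      then show ?thesis
        using Neg border_not_mem by (auto simp: v_def)
    qed
    then show ?thesis using L by blast
  qed
  then show ?thesis by (auto simp: satisfiable_def)
qed


subsection \<open>From a satisfying assignment to a border basis\<close>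

text \<open>Intended as the degree 7 part of the border; \<open>f l\<close> is the literal chosen to
  satisfy clause \<open>l\<close>.\<close>

definition leading_terms ::
    "('m::finite \<Rightarrow> 'n literal set) \<Rightarrow> ('n \<Rightarrow> bool) \<Rightarrow> ('m \<Rightarrow> 'n literal) \<Rightarrow> ('n, 'm) indet pterm set" where
  "leading_terms cl v f = F2_terms cl \<union> {t_lit cl L | L. \<not> holds v L} \<union> range (\<lambda>l. t_clause cl (f l) l)"

lemma t_lit_in_leading_terms: "t_lit cl L \<in> leading_terms cl v f \<longleftrightarrow> \<not> holds v L"
  using t_lit_notin_F2_terms[of cl L]
  by (auto simp: leading_terms_def t_lit_inject t_clause_neq_t_lit[symmetric])

lemma t_clause_in_leading_terms:
  "L \<in> cl l \<Longrightarrow> t_clause cl L l \<in> leading_terms cl v f \<longleftrightarrow> f l = L"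
  using t_clause_notin_F2_terms[of L cl l]
  by (auto simp: leading_terms_def t_clause_inject t_clause_neq_t_lit)

text \<open>
  A member of \<open>leading_terms\<close> that is not some \<open>t\<^sub>L\<close> contains exactly one \<open>x\<close> with subscript \<open>c\<^sub>l\<close>, because
  the child of \<open>t\<^sub>L\<cdot>x\<close> without it is \<open>t\<^sub>L\<close> itself.
\<close>

lemma leading_terms_cases:
  assumes "\<And>l. f l \<in> cl l" "s \<in> leading_terms cl v f"
  obtains (lit) L where "s = t_lit cl L" "\<not> holds v L"
    | (child) L l y where "L \<in> cl l" "s + ind y = t_lit cl L + ind (Xc l)" "lookup s (Xc l) = 1"
proof -
  consider "s \<in> F2_terms cl" | L where "s = t_lit cl L" "\<not> holds v L" | l where "s = t_clause cl (f l) l"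
    using assms(2) by (auto simp: leading_terms_def)
  then show ?thesis
  proof cases
    case 1
    then obtain L l y where *: "L \<in> cl l" "s + ind y = t_lit cl L + ind (Xc l)"
      by (auto simp: F2_terms_def mem_R_var)
    have "s \<noteq> t_lit cl L" using 1 t_lit_notin_F2_terms by blast
    then have "y \<noteq> Xc l" using *(2) by auto
    then have "lookup s (Xc l) = 1"
      using arg_cong[OF *(2), of "\<lambda>t. lookup t (Xc l)"] by (simp add: lookup_add lookup_ind lookup_t_lit)
    with * child show ?thesis by blast
  next
    case 2
    then show ?thesis using lit by blast
  next
    case 3
    have "lookup s (Xc l) = 1"
      using 3 by (simp add: lookup_t_clause lookup_t_lit)
    then show ?thesis
      using 3 child t_clause_add_ind assms(1) by metis
  qed
qed

section \<open>Degrees in the \<open>x_i\<close> and their overlined partners, and in the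
  \<open>x\<close> with subscript \<open>c_l\<close>\<close>

definition x_degree :: "('n::finite, 'm) indet pterm \<Rightarrow> nat" where
  "x_degree t = (\<Sum>i\<in>UNIV. lookup t (Xp i) + lookup t (Xn i))"

definition xc_degree :: "('n, 'm::finite) indet pterm \<Rightarrow> nat" where
  "xc_degree t = (\<Sum>l\<in>UNIV. lookup t (Xc l))"

lemma x_degree_add: "x_degree (s + t) = x_degree s + x_degree t"
  by (simp add: x_degree_def lookup_add sum.distrib)

lemma xc_degree_add: "xc_degree (s + t) = xc_degree s + xc_degree t"
  by (simp add: xc_degree_def lookup_add sum.distrib)

lemma x_degree_ind:
  "x_degree (ind y) = (case y of Xp _ \<Rightarrow> 1 | Xn _ \<Rightarrow> 1 | _ \<Rightarrow> 0)"
  by (cases y) (auto simp: x_degree_def lookup_ind)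

lemma xc_degree_ind: "xc_degree (ind y) = (case y of Xc _ \<Rightarrow> 1 | _ \<Rightarrow> 0)"
  by (cases y) (auto simp: xc_degree_def lookup_ind)

lemma x_degree_t_lit: "x_degree (t_lit cl L) = 3"
  by (cases L) (auto simp: x_degree_def lookup_t_lit sum.distrib)

lemma xc_degree_t_lit: "xc_degree (t_lit cl L) = 0"
  by (simp add: xc_degree_def lookup_t_lit)

text \<open>If all children of \<open>t\<close> were leading terms, comparing the two degrees above
  would force \<open>t\<close> to be some \<open>t_lit cl L + ind (Xc m)\<close> with
  \<open>L\<close> false and in clause \<open>m\<close>. Then its child
  \<open>t_clause cl L m\<close> would be leading, although \<open>f m\<close> is true.\<close>

lemma ex_child_not_leading:
  fixes cl :: "'m::finite \<Rightarrow> 'n::finite literal set"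
  assumes occ: "\<And>L. \<exists>l. L \<in> cl l"
    and f: "\<And>l. f l \<in> cl l" "\<And>l. holds v (f l)"
    and t: "0 < total_degree t"
  shows "\<exists>s y. s + ind y = t \<and> s \<notin> leading_terms cl v f"
proof (rule ccontr)
  assume "\<not> ?thesis"
  then have B: "s \<in> leading_terms cl v f" if "s + ind y = t" for s y
    using that by blast
  have xc_le: "xc_degree s \<le> 1" if "s \<in> leading_terms cl v f" for s
    using f(1) that
  proof (cases rule: leading_terms_cases)
    case child
    show ?thesis
      using arg_cong[OF child(2), of xc_degree] by (simp add: xc_degree_add xc_degree_t_lit xc_degree_ind)
  qed (simp add: xc_degree_t_lit)
  have t_lit: "\<exists>L. s = t_lit cl L \<and> \<not> holds v L"
    if "s \<in> leading_terms cl v f" "xc_degree s = 0" for s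
    using f(1) that(1)
  proof (cases rule: leading_terms_cases)
    case child
    then show ?thesis using that(2) by (auto simp: xc_degree_def)
  qed auto
  show False
  proof (cases "xc_degree t = 0")
    case True
    have no_xc: "\<exists>L. s = t_lit cl L" if "s + ind y = t" for s y
      using t_lit[OF B[OF that]] True that xc_degree_add by (metis add_is_0)
    obtain y where "0 < lookup t y"
      using t ex_lookup_pos by blast
    then obtain s where s: "s + ind y = t"
      by (rule obtain_child)
    then obtain L where L: "s = t_lit cl L"
      using no_xc by blast
    \<comment> \<open>As \<open>L\<close> occurs in a clause, \<open>t\<close> can be divided both
      by an \<open>x\<close>-indeterminate and by some \<open>Cl l\<close>. Both children would have
      \<open>x_degree\<close> 3, making \<open>x_degree t\<close> both 4 and 3.\<close>
    obtain l where l: "L \<in> cl l" using occ by blast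
    have "0 < lookup t (Xp (variable_of L))" "0 < lookup t (Cl l)"
      using mem_occurrences[where cl = cl, OF l]
      by (cases L; auto simp: s[symmetric] L lookup_add lookup_t_lit lookup_t_C)+
    then obtain s1 s2 where s12: "s1 + ind (Xp (variable_of L)) = t" "s2 + ind (Cl l) = t"
      by (elim obtain_child)
    then have "x_degree s1 = 3" "x_degree s2 = 3"
      using no_xc x_degree_t_lit by metis+
    then show False
      using arg_cong[OF s12(1), of x_degree] arg_cong[OF s12(2), of x_degree]
      by (simp add: x_degree_add x_degree_ind)
  next
    case False
    then obtain m where "0 < lookup t (Xc m)"
      unfolding xc_degree_def by (metis gr_zeroI sum.neutral)
    then obtain s where s: "s + ind (Xc m) = t"
      by (rule obtain_child)
    have xc_t: "xc_degree t = Suc (xc_degree s)"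
      using arg_cong[OF s, of xc_degree] by (simp add: xc_degree_add xc_degree_ind)
    have x_t: "x_degree t = x_degree s"
      using arg_cong[OF s, of x_degree] by (simp add: x_degree_add x_degree_ind)
    \<comment> \<open>Needed to find an \<open>x\<close>-indeterminate dividing \<open>t\<close>: a
      leading term has \<open>x_degree\<close> 3, or at least 2 as a child of some
      \<open>t_lit cl L + ind (Xc l)\<close>.\<close>
    have "0 < x_degree s"
      using f(1) B[OF s]
    proof (cases rule: leading_terms_cases)
      case (child L l y)
      show ?thesis
        using arg_cong[OF child(2), of x_degree]
        by (cases y) (simp_all add: x_degree_add x_degree_ind x_degree_t_lit)
    qed (simp add: x_degree_t_lit)
    then have "x_degree t \<noteq> 0" using x_t by simp
    have "\<exists>i. 0 < lookup t (Xp i) + lookup t (Xn i)"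
    proof (rule ccontr)
      assume "\<not> ?thesis"
      then have "x_degree t = 0" by (simp add: x_degree_def)
      with \<open>x_degree t \<noteq> 0\<close> show False ..
    qed
    then obtain i where "0 < lookup t (Xp i) \<or> 0 < lookup t (Xn i)" by auto
    then obtain y where y: "0 < lookup t y" "y \<in> range Xp \<union> range Xn" by blast
    from y(1) obtain s1 where s1: "s1 + ind y = t"
      by (rule obtain_child)
    \<comment> \<open>Removing an \<open>x\<close>-indeterminate keeps \<open>xc_degree\<close>, so
      the bound for leading terms applies to \<open>t\<close> itself and leaves 0 for
      \<open>s\<close>.\<close>
    have "xc_degree s1 = xc_degree t"
      using y(2) arg_cong[OF s1, of xc_degree] by (auto simp: xc_degree_add xc_degree_ind)
    then have "xc_degree s = 0"
      using xc_le[OF B[OF s1]] xc_t by simp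
    then obtain L where L: "s = t_lit cl L" "\<not> holds v L"
      using t_lit[OF B[OF s]] by blast
    have t_eq: "t = t_lit cl L + ind (Xc m)" using s L by simp
    \<comment> \<open>Dividing by the \<open>x\<close>-indeterminate of exponent 1 keeps the exponent 2 that identifies \<open>L\<close>.\<close>
    define z :: "('n, 'm) indet" where "z = (case L of Pos i \<Rightarrow> Xp i | Neg i \<Rightarrow> Xn i)"
    have "0 < lookup t z"
      by (cases L) (auto simp: z_def t_eq lookup_add lookup_t_lit)
    then obtain s2 where s2: "s2 + ind z = t"
      by (rule obtain_child)
    have look_s2: "lookup s2 (Xc l) = (if l = m then 1 else 0)" for l
      using arg_cong[OF s2, of "\<lambda>t. lookup t (Xc l)"]
      by (cases L) (auto simp: z_def t_eq lookup_add lookup_ind lookup_t_lit)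
    \<comment> \<open>\<open>s2\<close> contains \<open>Xc m\<close>, so it is a child of a term
      built from a literal of clause \<open>m\<close>. Its exponent 2 in
      \<open>double_indet L\<close> cannot be exceeded and identifies this literal as
      \<open>L\<close>.\<close>
    have "L \<in> cl m"
      using f(1) B[OF s2]
    proof (cases rule: leading_terms_cases)
      case (lit L')
      then show ?thesis using look_s2[of m] by (simp add: lookup_t_lit)
    next
      case (child L' l y')
      have "l = m" using child(3) look_s2 by (simp split: if_splits)
      have "2 \<le> lookup (t_lit cl L') (double_indet L)"
      proof -
        have "lookup s2 (double_indet L) = 2"
          using arg_cong[OF s2, of "\<lambda>t. lookup t (double_indet L)"] lookup_double_indet[of cl L L]
          by (cases L) (simp_all add: z_def t_eq lookup_add lookup_ind)
        then show ?thesis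
          using arg_cong[OF child(2), of "\<lambda>t. lookup t (double_indet L)"]
          by (simp add: lookup_add lookup_ind split: if_splits)
      qed
      moreover have "lookup (t_lit cl L') (double_indet L) \<le> 2"
        by (cases L; cases L') (simp_all add: lookup_t_lit)
      ultimately have "L' = L"
        using lookup_double_indet[of cl L' L] by simp
      then show ?thesis using child(1) \<open>l = m\<close> by simp
    qed
    then have "t_clause cl L m \<in> leading_terms cl v f"
      using t_clause_add_ind[of L cl m] t_eq by (intro B) simp
    then have "f m = L"
      using \<open>L \<in> cl m\<close> by (simp add: t_clause_in_leading_terms)
    then show False using f(2)[of m] L(2) by simp
  qed
qed

text \<open>Only terms of the top degree 7 are removed, so \<open>T\<close> stays closed under
  divisors, and \<open>border_basis_criterion\<close> applies with \<open>d = 7\<close>.\<close>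

lemma border_basis_if_satisfiable:
  fixes cl :: "'m::finite \<Rightarrow> 'n::finite literal set"
  assumes sat: "is_34SAT cl" and occ: "\<And>L. \<exists>l. L \<in> cl l"
    and f: "\<And>l. f l \<in> cl l" "\<And>l. holds v (f l)"
  defines "T \<equiv> {t. total_degree t \<le> 7} - leading_terms cl v f"
  shows "order_ideal T"
    and "border_basis T (F_all cl :: (('n, 'm) indet, 'k::field) mpoly set) (ideal_generated (F_all cl))"
proof -
  let ?B = "leading_terms cl v f"
  have B7: "total_degree t = 7" if "t \<in> ?B" for t
    using that total_degree_t_lit[OF sat] total_degree_t_clause[OF sat f(1)] total_degree_F2_terms[OF sat]
    by (auto simp: leading_terms_def)
  have low: "t \<in> T" if "total_degree t < 7" for t
    using that B7[of t] by (auto simp: T_def)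
  show "order_ideal T"
    unfolding order_ideal_def
  proof (intro conjI ballI allI impI)
    show "T \<noteq> {}" using low[of 0] by (auto simp: total_degree_def)
    show "finite T" by (simp add: T_def finite_total_degree_le)
    fix t s assume t: "t \<in> T" "term_dvd s t"
    then obtain u where u: "t = s + u" by (auto simp: term_dvd_def)
    show "s \<in> T"
    proof (cases "u = 0")
      case True
      then show ?thesis using t u by simp
    next
      case False
      then have "0 < total_degree u" using total_degree_eq_0_iff[of u] by simp
      then have "total_degree s < 7"
        using t(1) u by (simp add: T_def total_degree_add)
      then show ?thesis by (rule low)
    qed
  qed
  \<comment> \<open>Children of a leading term have degree 6 and lie in \<open>T\<close>; for degree
    8 a child in \<open>T\<close> is provided by \<open>ex_child_not_leading\<close>.\<close>
  have border: "border T = {t. total_degree t = 8} \<union> ?B"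
  proof (intro set_eqI iffI)
    fix t assume "t \<in> border T"
    then obtain y s where "t = ind y + s" "s \<in> T" "t \<notin> T" by (auto simp: border_def)
    then show "t \<in> {t. total_degree t = 8} \<union> ?B"
      by (auto simp: T_def total_degree_add)
  next
    fix t assume t: "t \<in> {t. total_degree t = 8} \<union> ?B"
    then have "t \<notin> T" by (auto simp: T_def)
    moreover have "\<exists>s y. s + ind y = t \<and> s \<in> T"
    proof (cases "t \<in> ?B")
      case True
      then have "0 < total_degree t" using B7 by simp
      then obtain y where "0 < lookup t y"
        using ex_lookup_pos by blast
      then obtain s where s: "s + ind y = t"
        by (rule obtain_child)
      then have "s \<in> T"
        using B7[OF True] low[of s] by (auto simp: total_degree_add)
      with s show ?thesis by blast
    next
      case False
      then have t8: "total_degree t = 8" using t by simp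
      then obtain s y where s: "s + ind y = t" "s \<notin> ?B"
        using ex_child_not_leading[OF occ f, of t] by auto
      then have "s \<in> T" using t8 by (auto simp: T_def total_degree_add)
      with s show ?thesis by blast
    qed
    ultimately show "t \<in> border T"
      unfolding border_def by (auto simp: add.commute)
  qed
  let ?F = "F_all cl :: (('n, 'm) indet, 'k) mpoly set"
  have lit_T: "t_lit cl L \<in> insert (t_lit cl L') T" if "variable_of L = variable_of L'" "\<not> holds v L'" for L L'
    using that t_lit_in_leading_terms[of cl L v f] total_degree_t_lit[OF sat, of L]
    by (cases L; cases L') (auto simp: T_def)
  have clause_T: "t_clause cl L l \<in> insert (t_clause cl (f l) l) T" if "L \<in> cl l" for L l
    using that t_clause_in_leading_terms[of L cl l v f] total_degree_t_clause[OF sat, of L l]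
    by (auto simp: T_def)
  have degree_keys: "7 \<le> total_degree t" if "p \<in> ?F" "t \<in> keys p" for p t
    using that
    by (cases rule: F_all_cases)
      (auto simp: total_degree_t_lit[OF sat] total_degree_t_clause[OF sat] total_degree_F2_terms[OF sat])
  have lead: "\<exists>b\<in>border T. lookup p b = 1 \<and> keys p \<subseteq> insert b T" if p: "p \<in> ?F" for p
  proof -
    consider i where "p = mon (t_lit cl (Pos i)) + mon (t_lit cl (Neg i))"
      | l where "p = (\<Sum>L\<in>cl l. mon (t_clause cl L l))"
      | t where "p = mon t" "total_degree t = 8 \<or> t \<in> F2_terms cl"
      using p by (auto simp: F_all_def F_v_def F_c_def F_1_def F_2_def F2_terms_def)
    then show ?thesis
    proof cases
      case (1 i)
      \<comment> \<open>The false literal of the variable \<open>i\<close> gives the leading term;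
        the term of the true one stays in \<open>T\<close>.\<close>
      define L where "L = (if v i then Neg i else Pos i)"
      have L: "variable_of L = i" "\<not> holds v L" by (auto simp: L_def)
      have "keys p \<subseteq> {t_lit cl (Pos i), t_lit cl (Neg i)}"
        unfolding 1
        using keys_add[of "mon (t_lit cl (Pos i)) :: (('n, 'm) indet, 'k) mpoly" "mon (t_lit cl (Neg i))"]
        by auto
      moreover have "{t_lit cl (Pos i), t_lit cl (Neg i)} \<subseteq> insert (t_lit cl L) T"
        using lit_T[of "Pos i" L] lit_T[of "Neg i" L] L by simp
      moreover have "lookup p (t_lit cl L) = 1"
        unfolding 1 lookup_F_v using L by simp
      moreover have "t_lit cl L \<in> border T"
        unfolding border using L t_lit_in_leading_terms by blast
      ultimately show ?thesis by blast
    next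
      case (2 l)
      have "keys p \<subseteq> insert (t_clause cl (f l) l) T"
      proof
        fix t assume "t \<in> keys p"
        then have "\<exists>L\<in>cl l. lookup (mon (t_clause cl L l) :: (('n, 'm) indet, 'k) mpoly) t \<noteq> 0"
          unfolding 2 by (auto simp: in_keys_iff lookup_sum intro: ccontr)
        then show "t \<in> insert (t_clause cl (f l) l) T"
          using clause_T by (auto simp: mon_def lookup_single when_def split: if_splits)
      qed
      moreover have "t_clause cl (f l) l \<in> border T"
        unfolding border by (simp add: leading_terms_def)
      moreover have "lookup p (t_clause cl (f l) l) = 1"
        unfolding 2 by (rule lookup_F_c[OF sat f(1)])
      ultimately show ?thesis by blast
    next
      case (3 t)
      then show ?thesis
        unfolding border by (auto simp: mon_def leading_terms_def intro!: bexI[of _ t])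
    qed
  qed
  have covers: "\<exists>p\<in>?F. b \<in> keys p" if b: "b \<in> border T" for b
  proof -
    consider "total_degree b = 8 \<or> b \<in> F2_terms cl"
      | L where "b = t_lit cl L"
      | l where "b = t_clause cl (f l) l"
      using b unfolding border leading_terms_def by blast
    then show ?thesis
    proof cases
      case 1
      then have "mon b \<in> ?F" by (auto simp: F_all_def F_1_def F_2_def F2_terms_def)
      then show ?thesis by (intro bexI[of _ "mon b"]) auto
    next
      case (2 L)
      let ?i = "variable_of L"
      let ?p = "mon (t_lit cl (Pos ?i)) + mon (t_lit cl (Neg ?i)) :: (('n, 'm) indet, 'k) mpoly"
      have "?p \<in> ?F" by (auto simp: F_all_def F_v_def)
      moreover have "b \<in> keys ?p" unfolding in_keys_iff 2 lookup_F_v by simp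
      ultimately show ?thesis by blast
    next
      case (3 l)
      let ?p = "\<Sum>L\<in>cl l. mon (t_clause cl L l) :: (('n, 'm) indet, 'k) mpoly"
      have "?p \<in> ?F" by (auto simp: F_all_def F_c_def)
      moreover have "b \<in> keys ?p" unfolding in_keys_iff 3 lookup_F_c[OF sat f(1)] by simp
      ultimately show ?thesis by blast
    qed
  qed
  show "border_basis T ?F (ideal_generated ?F)"
  proof (rule border_basis_criterion[of 7])
    show "mon t \<in> ?F" if "total_degree t = Suc 7" for t
      using that by (auto simp: F_all_def F_1_def)
    show "p = q" if "p \<in> ?F" "q \<in> ?F" "t \<in> keys p" "t \<in> keys q" for p q t
      using F_all_disjoint[OF sat that] .
  qed (use low degree_keys lead covers in \<open>auto simp: T_def\<close>)
qed

theorem theorem3p13: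
  fixes cl :: "'m::finite \<Rightarrow> 'n::finite literal set"
    and F :: "(('n, 'm) indet, 'k::field) mpoly set"
  assumes "is_34SAT cl"
    and "\<And>i. (\<exists>l. Pos i \<in> cl l) \<and> (\<exists>l. Neg i \<in> cl l)"
    and "\<And>i l. \<not> (Pos i \<in> cl l \<and> Neg i \<in> cl l)"
    and "F = F_all cl"
  shows "satisfiable cl \<longleftrightarrow>
    (\<exists>T :: ('n, 'm) indet pterm set. order_ideal T \<and> border_basis T F (ideal_generated F))"
proof
  assume "satisfiable cl"
  \<comment> \<open>\<open>f\<close> picks a true literal in every clause.\<close>
  then obtain v f where f: "\<And>l. f l \<in> cl l" "\<And>l. holds v (f l)"
    unfolding satisfiable_def by metis
  have "\<exists>l. L \<in> cl l" for L
    using assms(2) by (cases L) auto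
  from border_basis_if_satisfiable[OF assms(1) this f] assms(4)
  show "\<exists>T :: ('n, 'm) indet pterm set. order_ideal T \<and> border_basis T F (ideal_generated F)"
    by blast
next
  assume "\<exists>T :: ('n, 'm) indet pterm set. order_ideal T \<and> border_basis T F (ideal_generated F)"
  then show "satisfiable cl"
    using satisfiable_if_border_prebasis[OF assms(1)] assms(4)
    unfolding order_ideal_def border_basis_def by blast
qed

end
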